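(* Let $R$ be a unital ring and let $M$ be a left $R$-module. Suppose that $\mathcal{S}(M)$ has deviation. Then all direct sum decompositions of $M$ are finite and every non-trivial (i.e. nonzero) direct summand of $M$ has a non-trivial indecomposable direct summand.
   Context: $\mathcal{S}(M)$ denotes the set of all direct summands of $M$, partially ordered by inclusion. A direct sum decomposition of $M$ is an internal decomposition $M=\bigoplus_{\alpha\in A}M_\alpha$ with all $M_\alpha$ nonzero; it is finite if $A$ is finite. The deviation $\mathrm{dev}\,A$ of a poset $A$ is defined recursively: $\mathrm{dev}\,A=-1$ if $A$ is discrete (i.e. $a\leq b$ in $A$ implies $a=b$); and $\mathrm{dev}\,A=\alpha$ for an ordinal $\alpha$ if $A$ does not have deviation $\beta$ for any $\beta<\alpha$ (including $\beta=-1$) and for every descending chain $a_1\geq a_2\geq\cdots$ in $A$ the interval $[a_{n+1},a_n]$, as a subposet of $A$, has deviation $<\alpha$ for all but finitely many $n$. A poset has deviation if $\mathrm{dev}\,A=\alpha$ for some such $\alpha$ (or $-1$). *)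

theory Defs
  imports "HOL-Algebra.Algebra" "HOL-Library.Option_ord"
begin

(* The library locale module requires a commutative base ring, so left modules over an
   arbitrary unital ring are introduced here, on the library's module record.  The locale
   submodule of the library does not involve commutativity and is used as it is. *)
locale left_module = R?: ring R + M?: abelian_group M
  for R :: "('r, 'b) ring_scheme" (structure) and M :: "('r, 'm, 'c) module_scheme" (structure) +
  assumes smult_closed:
      "\<lbrakk>a \<in> carrier R; x \<in> carrier M\<rbrakk> \<Longrightarrow> a \<odot>\<^bsub>M\<^esub> x \<in> carrier M"
    and smult_l_distr:
      "\<lbrakk>a \<in> carrier R; b \<in> carrier R; x \<in> carrier M\<rbrakk> \<Longrightarrow>
        (a \<oplus>\<^bsub>R\<^esub> b) \<odot>\<^bsub>M\<^esub> x = a \<odot>\<^bsub>M\<^esub> x \<oplus>\<^bsub>M\<^esub> b \<odot>\<^bsub>M\<^esub> x"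
    and smult_r_distr:
      "\<lbrakk>a \<in> carrier R; x \<in> carrier M; y \<in> carrier M\<rbrakk> \<Longrightarrow>
        a \<odot>\<^bsub>M\<^esub> (x \<oplus>\<^bsub>M\<^esub> y) = a \<odot>\<^bsub>M\<^esub> x \<oplus>\<^bsub>M\<^esub> a \<odot>\<^bsub>M\<^esub> y"
    and smult_assoc1:
      "\<lbrakk>a \<in> carrier R; b \<in> carrier R; x \<in> carrier M\<rbrakk> \<Longrightarrow>
        (a \<otimes>\<^bsub>R\<^esub> b) \<odot>\<^bsub>M\<^esub> x = a \<odot>\<^bsub>M\<^esub> (b \<odot>\<^bsub>M\<^esub> x)"
    and smult_one:
      "x \<in> carrier M \<Longrightarrow> \<one>\<^bsub>R\<^esub> \<odot>\<^bsub>M\<^esub> x = x"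

lemma (in left_module) submodule_is_left_module:
  assumes "submodule H R M"
  shows "left_module R (M\<lparr>carrier := H\<rparr>)"
proof -
  interpret H: submodule H R M by fact
  have sub: "\<And>x. x \<in> H \<Longrightarrow> x \<in> carrier M"
    using H.subset by auto
  have "abelian_monoid (M\<lparr>carrier := H\<rparr>)"
    using comm_monoid.submonoid_is_comm_monoid[OF M.a_comm_monoid H.subgroup_is_submonoid]
    by (simp add: abelian_monoid_def)
  moreover from this have "abelian_group_axioms (M\<lparr>carrier := H\<rparr>)"
    using H.subgroup_is_group M.a_group
    by (simp add: abelian_group_axioms_def comm_group_def abelian_monoid_def)
  ultimately have "abelian_group (M\<lparr>carrier := H\<rparr>)"
    by (rule abelian_group.intro)
  then show ?thesis
    by (intro left_module.intro R.ring_axioms left_module_axioms.intro)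
      (auto simp: sub smult_l_distr smult_r_distr smult_assoc1 smult_one)
qed

definition is_direct_sum :: "('r, 'b) ring_scheme \<Rightarrow> ('r, 'm, 'c) module_scheme
    \<Rightarrow> 'm set \<Rightarrow> 'm set \<Rightarrow> bool" where
  "is_direct_sum R M N K \<longleftrightarrow>
     submodule N R M \<and> submodule K R M \<and>
     N \<inter> K = {\<zero>\<^bsub>M\<^esub>} \<and> N <+>\<^bsub>M\<^esub> K = carrier M"

definition direct_summands :: "('r, 'b) ring_scheme \<Rightarrow> ('r, 'm, 'c) module_scheme
    \<Rightarrow> 'm set set" where
  "direct_summands R M = {N. \<exists>K. is_direct_sum R M N K}"

definition direct_sum_decomposition :: "('r, 'b) ring_scheme \<Rightarrow> ('r, 'm, 'c) module_scheme
    \<Rightarrow> 'i set \<Rightarrow> ('i \<Rightarrow> 'm set) \<Rightarrow> bool" where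
  "direct_sum_decomposition R M I N \<longleftrightarrow>
     (\<forall>i\<in>I. submodule (N i) R M \<and> N i \<noteq> {\<zero>\<^bsub>M\<^esub>}) \<and>
     (\<forall>x\<in>carrier M. \<exists>!c. c \<in> (\<Pi>\<^sub>E i\<in>I. N i) \<and> finite {i\<in>I. c i \<noteq> \<zero>\<^bsub>M\<^esub>} \<and>
        x = (\<Oplus>\<^bsub>M\<^esub> i\<in>{i\<in>I. c i \<noteq> \<zero>\<^bsub>M\<^esub>}. c i))"

definition indecomposable :: "('r, 'b) ring_scheme \<Rightarrow> ('r, 'm, 'c) module_scheme \<Rightarrow> bool" where
  "indecomposable R M \<longleftrightarrow>
     carrier M \<noteq> {\<zero>\<^bsub>M\<^esub>} \<and>
     (\<forall>N K. is_direct_sum R M N K \<longrightarrow> N = {\<zero>\<^bsub>M\<^esub>} \<or> K = {\<zero>\<^bsub>M\<^esub>})"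

definition interval_in :: "'a::order set \<Rightarrow> 'a \<Rightarrow> 'a \<Rightarrow> 'a set" where
  "interval_in A a b = {x\<in>A. a \<le> x \<and> x \<le> b}"

(* has_dev alpha A: the poset A (a subset of an ordered type, with the induced order) has
   deviation alpha.  An element of a well-ordered type stands for the ordinal that is the
   order type of its set of predecessors; None, the least element of the option type,
   stands for -1.  Only the predecessors of alpha enter the recursion, so the meaning does
   not depend on which well-order alpha is taken from.  A hypothesis that A has deviation,
   an existential over all ordinals, is expressed as has_dev alpha A with alpha and its
   well-ordered type both arbitrary. *)
context
  notes conj_cong [fundef_cong]
begin

function has_dev :: "'o::wellorder option \<Rightarrow> 'a::order set \<Rightarrow> bool" where
  "has_dev None A \<longleftrightarrow> (\<forall>a\<in>A. \<forall>b\<in>A. a \<le> b \<longrightarrow> a = b)"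
| "has_dev (Some \<alpha>) A \<longleftrightarrow>
     (\<forall>\<beta>. \<beta> < Some \<alpha> \<longrightarrow> \<not> has_dev \<beta> A) \<and>
     (\<forall>a::nat \<Rightarrow> 'a. (\<forall>n. a n \<in> A) \<and> (\<forall>n. a (Suc n) \<le> a n) \<longrightarrow>
        finite {n. \<not> (\<exists>\<beta>. \<beta> < Some \<alpha> \<and> has_dev \<beta> (interval_in A (a (Suc n)) (a n)))})"
  by pat_completeness auto
termination
  by (relation "inv_image {(x, y). x < y} fst") (auto intro: wf_inv_image wf)

end

lemma has_dev_unique:
  assumes "has_dev \<alpha> A" and "has_dev \<beta> A"
  shows "\<alpha> = \<beta>"
proof -
  have less: "\<not> has_dev \<gamma> A" if "\<gamma> < \<delta>" "has_dev \<delta> A" for \<gamma> \<delta> :: "'a option"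
    using that by (cases \<delta>) auto
  show ?thesis
    using assms less by (meson linorder_neqE)
qed

end

theory Submission
  imports Defs
begin

text \<open>
  Both claims hold for the same reason: a counterexample to either one contains a nonzero summand
  that can be split again and again, and such splitting produces densely ordered chains of direct
  summands, which deviation forbids.

  On the order side, call a relation \<open>T\<close> of pairs \<open>a < b\<close> splitting if every \<open>T a b\<close> admits a \<open>c\<close>
  with \<open>T a c\<close> and \<open>T c b\<close>. Splitting off the upper part repeatedly, with \<open>a\<close> kept fixed, gives a
  descending chain in \<open>[a, b]\<close> all of whose successive intervals are again bounded by pairs in \<open>T\<close>.
  By induction on \<open>\<alpha>\<close>, none of these intervals has deviation below \<open>\<alpha>\<close>, so \<open>[a, b]\<close> does not have
  deviation \<open>\<alpha>\<close> (\<open>splitting_pairs_no_deviation\<close>).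

  On the module side, let \<open>G\<close> be a family of nonzero submodules, each of which is the direct sum
  of two members of \<open>G\<close>, and suppose that some member of \<open>G\<close> is a direct summand of \<open>M\<close>. Relate two
  summands \<open>A\<close> and \<open>B\<close> if there is room for a member of \<open>G\<close> between them, that is, if \<open>A \<oplus> L\<close> is a
  summand of \<open>M\<close> contained in \<open>B\<close> for some \<open>L \<in> G\<close>. If \<open>L = L1 \<oplus> L2\<close>, then \<open>A \<oplus> L1\<close> lies between
  \<open>A\<close> and \<open>B\<close>, with room for \<open>L1\<close> below it and for \<open>L2\<close> above it. So the relation is splitting; it
  holds between \<open>0\<close> and \<open>M\<close>, and the poset of summands has no deviation
  (\<open>splitting_family_no_deviation\<close>).

  It remains to name the families. If a nonzero summand \<open>N\<close> has no nonzero indecomposable summand,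
  the nonzero summands of \<open>N\<close> form such a family. If \<open>M\<close> is a direct sum over an infinite index set
  \<open>I\<close>, the partial sums over the infinite subsets of \<open>I\<close> do, since every infinite set is the disjoint
  union of two infinite sets.
\<close>

section \<open>Posets in which splitting never ends have no deviation\<close>

lemma interval_in_interval_in:
  assumes "a \<le> c" "d \<le> b"
  shows "interval_in (interval_in A a b) c d = interval_in A c d"
  using assms by (auto simp: interval_in_def)

text \<open>
  Dense chains are phrased through a relation \<open>T\<close> because the application makes no canonical
  choice of intermediate elements. The induction on \<open>\<alpha>\<close> covers all pairs in \<open>T\<close> at once, so its
  hypothesis applies to each interval that a step of the chain cuts off.
\<close>

lemma splitting_pairs_no_deviation:
  fixes A :: "'a::order set" and \<alpha> :: "'o::wellorder option"
  assumes strict: "\<And>a b. T a b \<Longrightarrow> a \<in> A \<and> b \<in> A \<and> a < b"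
    and split: "\<And>a b. T a b \<Longrightarrow> \<exists>c. T a c \<and> T c b"
    and "T a b"
  shows "\<not> has_dev \<alpha> (interval_in A a b)"
  using \<open>T a b\<close>
proof (induction \<alpha> arbitrary: a b rule: less_induct)
  case (less \<alpha>)
  note ab = strict[OF less.prems]
  show ?case
  proof (cases \<alpha>)
    case None
    have "a \<in> interval_in A a b" "b \<in> interval_in A a b"
      using ab by (auto simp: interval_in_def)
    with ab None show ?thesis
      by (auto dest: less_imp_le)
  next
    case (Some \<gamma>)
    obtain s where s: "\<And>x y. T x y \<Longrightarrow> T x (s x y) \<and> T (s x y) y"
      using split by metis
    \<comment> \<open>The lower end \<open>a\<close> stays fixed and the upper end moves down; what each step cuts off is
      again an interval between two elements related by \<open>T\<close>.\<close>
    define c where "c n = (s a ^^ n) b" for n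
    have Tac: "T a (c n)" for n
      by (induction n) (use less.prems s in \<open>auto simp: c_def\<close>)
    have Tcc: "T (c (Suc n)) (c n)" for n
      using s[OF Tac[of n]] by (simp add: c_def)
    have dec: "c (Suc n) \<le> c n" for n
      using strict[OF Tcc[of n]] by (auto intro: less_imp_le)
    have "c n \<le> b" for n
      by (induction n) (use dec order_trans in \<open>auto simp: c_def\<close>)
    with Tac strict have c_in: "c n \<in> interval_in A a b" for n
      by (auto simp: interval_in_def less_imp_le)
    have eq: "interval_in (interval_in A a b) (c (Suc n)) (c n) =
        interval_in A (c (Suc n)) (c n)" for n
      using c_in by (intro interval_in_interval_in) (auto simp: interval_in_def)
    have bad: "{n. \<not> (\<exists>\<beta>. \<beta> < Some \<gamma> \<and>
        has_dev \<beta> (interval_in (interval_in A a b) (c (Suc n)) (c n)))} = UNIV"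
      using less.IH[OF _ Tcc] Some by (auto simp: eq)
    show ?thesis
    proof
      assume "has_dev \<alpha> (interval_in A a b)"
      with Some c_in dec have "finite {n. \<not> (\<exists>\<beta>. \<beta> < Some \<gamma> \<and>
          has_dev \<beta> (interval_in (interval_in A a b) (c (Suc n)) (c n)))}"
        by simp
      then show False
        unfolding bad by simp
    qed
  qed
qed

section \<open>Submodules and direct sums\<close>

context left_module
begin

lemma submoduleI:
  assumes "H \<subseteq> carrier M" "\<zero>\<^bsub>M\<^esub> \<in> H"
    and "\<And>x y. \<lbrakk>x \<in> H; y \<in> H\<rbrakk> \<Longrightarrow> x \<oplus>\<^bsub>M\<^esub> y \<in> H"
    and smult: "\<And>r x. \<lbrakk>r \<in> carrier R; x \<in> H\<rbrakk> \<Longrightarrow> r \<odot>\<^bsub>M\<^esub> x \<in> H"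
  shows "submodule H R M"
proof -
  \<comment> \<open>Negation is multiplication by the scalar \<open>- 1\<close>.\<close>
  have neg: "\<ominus>\<^bsub>M\<^esub> x \<in> H" if "x \<in> H" for x
  proof -
    have x: "x \<in> carrier M"
      using that assms(1) by blast
    have z: "\<zero>\<^bsub>R\<^esub> \<odot>\<^bsub>M\<^esub> x = \<zero>\<^bsub>M\<^esub>"
      using smult_l_distr[of "\<zero>\<^bsub>R\<^esub>" "\<zero>\<^bsub>R\<^esub>" x] x smult_closed[of "\<zero>\<^bsub>R\<^esub>" x]
      by simp
    have "(\<ominus>\<^bsub>R\<^esub> \<one>\<^bsub>R\<^esub>) \<odot>\<^bsub>M\<^esub> x \<oplus>\<^bsub>M\<^esub> x = \<zero>\<^bsub>M\<^esub>"
      using smult_l_distr[of "\<ominus>\<^bsub>R\<^esub> \<one>\<^bsub>R\<^esub>" "\<one>\<^bsub>R\<^esub>" x] x z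
      by (simp add: smult_one R.l_neg)
    then have "\<ominus>\<^bsub>M\<^esub> x = (\<ominus>\<^bsub>R\<^esub> \<one>\<^bsub>R\<^esub>) \<odot>\<^bsub>M\<^esub> x"
      using x smult_closed by (intro M.minus_equality) auto
    then show ?thesis
      using smult[OF _ that] by simp
  qed
  show ?thesis
    by (intro submodule.intro subgroup.intro submodule_axioms.intro)
      (use assms neg in \<open>auto simp: a_inv_def\<close>)
qed

lemma submoduleD:
  assumes "submodule H R M"
  shows "H \<subseteq> carrier M" "\<zero>\<^bsub>M\<^esub> \<in> H"
    and "\<And>x y. \<lbrakk>x \<in> H; y \<in> H\<rbrakk> \<Longrightarrow> x \<oplus>\<^bsub>M\<^esub> y \<in> H"
    and "\<And>x. x \<in> H \<Longrightarrow> \<ominus>\<^bsub>M\<^esub> x \<in> H"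
    and "\<And>r x. \<lbrakk>r \<in> carrier R; x \<in> H\<rbrakk> \<Longrightarrow> r \<odot>\<^bsub>M\<^esub> x \<in> H"
proof -
  interpret submodule H R M by fact
  show "H \<subseteq> carrier M" "\<zero>\<^bsub>M\<^esub> \<in> H"
    "\<And>x y. \<lbrakk>x \<in> H; y \<in> H\<rbrakk> \<Longrightarrow> x \<oplus>\<^bsub>M\<^esub> y \<in> H"
    "\<And>x. x \<in> H \<Longrightarrow> \<ominus>\<^bsub>M\<^esub> x \<in> H"
    "\<And>r x. \<lbrakk>r \<in> carrier R; x \<in> H\<rbrakk> \<Longrightarrow> r \<odot>\<^bsub>M\<^esub> x \<in> H"
    using subset one_closed m_closed m_inv_closed smult_closed by (auto simp: a_inv_def)
qed

lemma submodule_subset: "submodule H R M \<Longrightarrow> x \<in> H \<Longrightarrow> x \<in> carrier M"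
  using submoduleD(1) by blast

lemma smult_zero:
  assumes "r \<in> carrier R"
  shows "r \<odot>\<^bsub>M\<^esub> \<zero>\<^bsub>M\<^esub> = \<zero>\<^bsub>M\<^esub>"
  using smult_r_distr[of r "\<zero>\<^bsub>M\<^esub>" "\<zero>\<^bsub>M\<^esub>"] smult_closed[of r "\<zero>\<^bsub>M\<^esub>"] assms by simp

lemma zero_submodule: "submodule {\<zero>\<^bsub>M\<^esub>} R M"
  by (rule submoduleI) (auto simp: smult_zero)

lemma carrier_submodule: "submodule (carrier M) R M"
  by (rule submoduleI) (auto simp: smult_closed)

lemma set_add_iff: "x \<in> A <+>\<^bsub>M\<^esub> B \<longleftrightarrow> (\<exists>a\<in>A. \<exists>b\<in>B. x = a \<oplus>\<^bsub>M\<^esub> b)"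
  by (auto simp: set_add_def')

lemma set_add_submodule:
  assumes A: "submodule A R M" and B: "submodule B R M"
  shows "submodule (A <+>\<^bsub>M\<^esub> B) R M"
proof (rule submoduleI)
  note [intro, simp] = submodule_subset[OF A] submodule_subset[OF B]
  show "A <+>\<^bsub>M\<^esub> B \<subseteq> carrier M"
    by (auto simp: set_add_iff)
  show "\<zero>\<^bsub>M\<^esub> \<in> A <+>\<^bsub>M\<^esub> B"
    using submoduleD(2)[OF A] submoduleD(2)[OF B] by (force simp: set_add_iff)
  show "x \<oplus>\<^bsub>M\<^esub> y \<in> A <+>\<^bsub>M\<^esub> B" if prem: "x \<in> A <+>\<^bsub>M\<^esub> B" "y \<in> A <+>\<^bsub>M\<^esub> B" for x y
  proof -
    obtain a b a' b' where ab: "a \<in> A" "b \<in> B" "a' \<in> A" "b' \<in> B"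
      and xy: "x = a \<oplus>\<^bsub>M\<^esub> b" "y = a' \<oplus>\<^bsub>M\<^esub> b'"
      using prem unfolding set_add_iff by blast
    have "x \<oplus>\<^bsub>M\<^esub> y = (a \<oplus>\<^bsub>M\<^esub> a') \<oplus>\<^bsub>M\<^esub> (b \<oplus>\<^bsub>M\<^esub> b')"
      using ab by (simp add: xy M.a_ac)
    then show ?thesis
      using ab submoduleD(3)[OF A] submoduleD(3)[OF B] by (force simp: set_add_iff)
  qed
  show "r \<odot>\<^bsub>M\<^esub> x \<in> A <+>\<^bsub>M\<^esub> B" if r: "r \<in> carrier R" and prem: "x \<in> A <+>\<^bsub>M\<^esub> B" for r x
  proof -
    obtain a b where ab: "a \<in> A" "b \<in> B" "x = a \<oplus>\<^bsub>M\<^esub> b"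
      using prem by (auto simp: set_add_iff)
    have "r \<odot>\<^bsub>M\<^esub> x = r \<odot>\<^bsub>M\<^esub> a \<oplus>\<^bsub>M\<^esub> r \<odot>\<^bsub>M\<^esub> b"
      using ab r by (simp add: smult_r_distr)
    then show ?thesis
      using ab r submoduleD(5)[OF A] submoduleD(5)[OF B] by (force simp: set_add_iff)
  qed
qed

lemma set_add_commute:
  assumes "submodule A R M" "submodule B R M"
  shows "A <+>\<^bsub>M\<^esub> B = B <+>\<^bsub>M\<^esub> A"
  using assms[THEN submodule_subset] by (auto simp: set_add_iff) (metis M.a_comm)+

lemma set_add_assoc:
  assumes "submodule A R M" "submodule B R M" "submodule C R M"
  shows "A <+>\<^bsub>M\<^esub> (B <+>\<^bsub>M\<^esub> C) = (A <+>\<^bsub>M\<^esub> B) <+>\<^bsub>M\<^esub> C"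
  using M.add.set_mult_assoc assms[THEN submoduleD(1)] by (simp add: set_add_def)

lemma set_add_zero:
  assumes "submodule A R M"
  shows "{\<zero>\<^bsub>M\<^esub>} <+>\<^bsub>M\<^esub> A = A"
  using submodule_subset[OF assms] by (force simp: set_add_iff)

lemma subset_set_add:
  assumes "submodule A R M" "submodule B R M"
  shows "A \<subseteq> A <+>\<^bsub>M\<^esub> B" "B \<subseteq> A <+>\<^bsub>M\<^esub> B"
proof -
  have "x = x \<oplus>\<^bsub>M\<^esub> \<zero>\<^bsub>M\<^esub>" if "x \<in> A" for x
    using submodule_subset[OF assms(1) that] by simp
  then show "A \<subseteq> A <+>\<^bsub>M\<^esub> B"
    using submoduleD(2)[OF assms(2)] by (fastforce simp: set_add_iff)
  have "x = \<zero>\<^bsub>M\<^esub> \<oplus>\<^bsub>M\<^esub> x" if "x \<in> B" for x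
    using submodule_subset[OF assms(2) that] by simp
  then show "B \<subseteq> A <+>\<^bsub>M\<^esub> B"
    using submoduleD(2)[OF assms(1)] by (fastforce simp: set_add_iff)
qed

text \<open>
  Rebracketing an internal direct sum of three submodules. Together with commutativity of the sum
  this lets a summand be moved from one side of a direct sum to the other.
\<close>

lemma independent_assoc:
  assumes A: "submodule A R M" and B: "submodule B R M" and C: "submodule C R M"
    and ABC: "A \<inter> (B <+>\<^bsub>M\<^esub> C) = {\<zero>\<^bsub>M\<^esub>}" and BC: "B \<inter> C = {\<zero>\<^bsub>M\<^esub>}"
  shows "(A <+>\<^bsub>M\<^esub> B) \<inter> C = {\<zero>\<^bsub>M\<^esub>}"
proof -
  have "x = \<zero>\<^bsub>M\<^esub>" if x: "x \<in> C" and "x \<in> A <+>\<^bsub>M\<^esub> B" for x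
  proof -
    obtain a b where ab: "a \<in> A" "b \<in> B" "x = a \<oplus>\<^bsub>M\<^esub> b"
      using \<open>x \<in> A <+>\<^bsub>M\<^esub> B\<close> by (auto simp: set_add_iff)
    note [simp] = submodule_subset[OF A ab(1)] submodule_subset[OF B ab(2)]
    have "a = \<ominus>\<^bsub>M\<^esub> b \<oplus>\<^bsub>M\<^esub> x"
      by (simp add: ab M.a_ac M.r_neg)
    then have "a \<in> B <+>\<^bsub>M\<^esub> C"
      using submoduleD(4)[OF B ab(2)] x by (auto simp: set_add_iff)
    then have "a = \<zero>\<^bsub>M\<^esub>"
      using ab ABC by blast
    then have "x = b"
      by (simp add: ab)
    then show ?thesis
      using ab x BC by blast
  qed
  moreover have "\<zero>\<^bsub>M\<^esub> \<in> (A <+>\<^bsub>M\<^esub> B) \<inter> C"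
    using submoduleD(2) set_add_submodule A B C by blast
  ultimately show ?thesis
    by blast
qed

text \<open>
  Direct sums inside a submodule are described by data in the ambient module, so that summands of
  summands can be handled without changing the module.
\<close>

lemma is_direct_sum_submodule_iff:
  assumes L: "submodule L R M"
  shows "is_direct_sum R (M\<lparr>carrier := L\<rparr>) A B \<longleftrightarrow>
    submodule A R M \<and> submodule B R M \<and> A \<inter> B = {\<zero>\<^bsub>M\<^esub>} \<and> A <+>\<^bsub>M\<^esub> B = L"
proof -
  interpret L: left_module R "M\<lparr>carrier := L\<rparr>"
    using submodule_is_left_module[OF L] .
  have sub: "submodule H R (M\<lparr>carrier := L\<rparr>) \<longleftrightarrow> submodule H R M \<and> H \<subseteq> L" for H
  proof safe
    assume H: "submodule H R (M\<lparr>carrier := L\<rparr>)"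
    show "submodule H R M"
      using L.submoduleD[OF H] submoduleD(1)[OF L] by (intro submoduleI) auto
  next
    assume H: "submodule H R M" and "H \<subseteq> L"
    then show "submodule H R (M\<lparr>carrier := L\<rparr>)"
      using submoduleD[OF H] by (intro L.submoduleI) auto
  qed (use L.submoduleD(1) in auto)
  have add: "A <+>\<^bsub>M\<lparr>carrier := L\<rparr>\<^esub> B = A <+>\<^bsub>M\<^esub> B"
    by (simp add: set_add_def set_mult_def)
  show ?thesis
    using subset_set_add[of A B] by (auto simp: is_direct_sum_def sub add)
qed

lemma direct_summandD: "A \<in> direct_summands R M \<Longrightarrow> submodule A R M"
  by (auto simp: direct_summands_def is_direct_sum_def)

lemma zero_carrier_direct_sum: "is_direct_sum R M {\<zero>\<^bsub>M\<^esub>} (carrier M)"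
  using zero_submodule carrier_submodule set_add_zero by (auto simp: is_direct_sum_def)

lemma direct_sum_commute: "is_direct_sum R M A B \<Longrightarrow> is_direct_sum R M B A"
  using set_add_commute by (auto simp: is_direct_sum_def)

lemma zero_direct_summand: "{\<zero>\<^bsub>M\<^esub>} \<in> direct_summands R M"
  using zero_carrier_direct_sum by (auto simp: direct_summands_def)

lemma carrier_direct_summand: "carrier M \<in> direct_summands R M"
  using direct_sum_commute[OF zero_carrier_direct_sum] by (auto simp: direct_summands_def)

text \<open>
  If \<open>K\<close> is a complement of \<open>A \<oplus> B\<close>, then \<open>B \<oplus> K\<close> is a complement of \<open>A\<close>.
\<close>

lemma direct_summand_left:
  assumes A: "submodule A R M" and B: "submodule B R M" and AB: "A \<inter> B = {\<zero>\<^bsub>M\<^esub>}"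
    and "A <+>\<^bsub>M\<^esub> B \<in> direct_summands R M"
  shows "A \<in> direct_summands R M"
proof -
  obtain K where K: "submodule K R M" "(A <+>\<^bsub>M\<^esub> B) \<inter> K = {\<zero>\<^bsub>M\<^esub>}"
      "(A <+>\<^bsub>M\<^esub> B) <+>\<^bsub>M\<^esub> K = carrier M"
    using assms(4) by (auto simp: direct_summands_def is_direct_sum_def)
  have "(K <+>\<^bsub>M\<^esub> B) \<inter> A = {\<zero>\<^bsub>M\<^esub>}"
    using K AB set_add_commute[OF A B] by (intro independent_assoc[OF K(1) B A]) auto
  then have "A \<inter> (B <+>\<^bsub>M\<^esub> K) = {\<zero>\<^bsub>M\<^esub>}"
    using set_add_commute[OF B K(1)] by blast
  then have "is_direct_sum R M A (B <+>\<^bsub>M\<^esub> K)"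
    using A B K by (simp add: is_direct_sum_def set_add_submodule set_add_assoc)
  then show ?thesis
    by (auto simp: direct_summands_def)
qed

text \<open>
  A splitting of \<open>L\<close> refines the step from \<open>A\<close> to \<open>A \<oplus> L\<close> in the poset of summands: \<open>A \<oplus> L1\<close> is
  again a summand of \<open>M\<close>, because a complement can absorb \<open>L2\<close>.
\<close>

lemma direct_summand_refine:
  assumes A: "submodule A R M" and L: "submodule L R M"
    and L12: "is_direct_sum R (M\<lparr>carrier := L\<rparr>) L1 L2"
    and AL: "A \<inter> L = {\<zero>\<^bsub>M\<^esub>}" "A <+>\<^bsub>M\<^esub> L \<in> direct_summands R M"
  shows "A <+>\<^bsub>M\<^esub> L1 \<in> direct_summands R M"
    and "(A <+>\<^bsub>M\<^esub> L1) \<inter> L2 = {\<zero>\<^bsub>M\<^esub>}"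
    and "(A <+>\<^bsub>M\<^esub> L1) <+>\<^bsub>M\<^esub> L2 = A <+>\<^bsub>M\<^esub> L"
proof -
  have 12: "submodule L1 R M" "submodule L2 R M" "L1 \<inter> L2 = {\<zero>\<^bsub>M\<^esub>}" "L1 <+>\<^bsub>M\<^esub> L2 = L"
    using L12 by (auto simp: is_direct_sum_submodule_iff[OF L])
  show disj: "(A <+>\<^bsub>M\<^esub> L1) \<inter> L2 = {\<zero>\<^bsub>M\<^esub>}"
    using 12 AL by (intro independent_assoc A) auto
  show sum: "(A <+>\<^bsub>M\<^esub> L1) <+>\<^bsub>M\<^esub> L2 = A <+>\<^bsub>M\<^esub> L"
    using 12 by (simp add: set_add_assoc[OF A, symmetric])
  show "A <+>\<^bsub>M\<^esub> L1 \<in> direct_summands R M"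
    using direct_summand_left[OF set_add_submodule[OF A 12(1)] 12(2) disj] AL sum by simp
qed

text \<open>
  The chain of summands is built from \<open>G\<close> as follows: if \<open>L \<in> G\<close> fits between \<open>A\<close> and \<open>B\<close> and
  \<open>L = L1 \<oplus> L2\<close>, then \<open>A \<oplus> L1\<close> is an intermediate summand, with \<open>L1\<close> fitting below it and
  \<open>L2\<close> above.
\<close>

lemma splitting_family_no_deviation:
  fixes \<alpha> :: "'o::wellorder option"
  assumes G: "\<And>L. L \<in> G \<Longrightarrow> submodule L R M \<and> L \<noteq> {\<zero>\<^bsub>M\<^esub>}"
    and split: "\<And>L. L \<in> G \<Longrightarrow> \<exists>L1\<in>G. \<exists>L2\<in>G. is_direct_sum R (M\<lparr>carrier := L\<rparr>) L1 L2"
    and N: "N \<in> G" "N \<in> direct_summands R M"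
  shows "\<not> has_dev \<alpha> (direct_summands R M)"
proof -
  \<comment> \<open>An inclusion \<open>A \<oplus> L \<subseteq> B\<close> in place of an equality gives \<open>T 0 M\<close> even if the given
    member of \<open>G\<close> is a proper summand, and the interval from \<open>0\<close> to \<open>M\<close> is the whole poset.\<close>
  define T where "T A B \<longleftrightarrow> A \<in> direct_summands R M \<and> B \<in> direct_summands R M \<and>
      (\<exists>L\<in>G. A \<inter> L = {\<zero>\<^bsub>M\<^esub>} \<and> A <+>\<^bsub>M\<^esub> L \<in> direct_summands R M \<and> A <+>\<^bsub>M\<^esub> L \<subseteq> B)" for A B
  have T_strict: "A \<in> direct_summands R M \<and> B \<in> direct_summands R M \<and> A \<subset> B" if prem: "T A B" for A B
  proof -
    obtain L where L: "L \<in> G" "A \<inter> L = {\<zero>\<^bsub>M\<^esub>}" "A <+>\<^bsub>M\<^esub> L \<subseteq> B"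
      using prem unfolding T_def by blast
    have A: "submodule A R M"
      using that by (auto simp: T_def direct_summandD)
    have "A \<subseteq> B" "L \<subseteq> B"
      using subset_set_add[OF A] G L by blast+
    moreover have "\<not> L \<subseteq> A"
      using L G by blast
    ultimately show ?thesis
      using that unfolding T_def by blast
  qed
  have T_split: "\<exists>C. T A C \<and> T C B" if AB: "T A B" for A B
  proof -
    obtain L where L: "L \<in> G" "A \<inter> L = {\<zero>\<^bsub>M\<^esub>}" "A <+>\<^bsub>M\<^esub> L \<in> direct_summands R M"
        "A <+>\<^bsub>M\<^esub> L \<subseteq> B"
      using AB unfolding T_def by blast
    obtain L1 L2 where 12: "L1 \<in> G" "L2 \<in> G" "is_direct_sum R (M\<lparr>carrier := L\<rparr>) L1 L2"
      using split L by blast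
    have A: "submodule A R M"
      using AB by (auto simp: T_def direct_summandD)
    note C = direct_summand_refine[OF A _ 12(3) L(2,3)]
    have L': "submodule L R M"
      using G L by blast
    have "L1 \<subseteq> L"
      using 12(3) subset_set_add by (auto simp: is_direct_sum_submodule_iff[OF L'])
    then have "A \<inter> L1 = {\<zero>\<^bsub>M\<^esub>}"
      using L A G[OF 12(1)] submoduleD(2) by blast
    then have "T A (A <+>\<^bsub>M\<^esub> L1)"
      unfolding T_def using AB[unfolded T_def] C(1)[OF L'] 12(1)
      by (intro conjI bexI[of _ L1]) simp_all
    moreover have "T (A <+>\<^bsub>M\<^esub> L1) B"
      unfolding T_def using AB[unfolded T_def] C[OF L'] 12(2) L(3,4)
      by (intro conjI bexI[of _ L2]) simp_all
    ultimately show ?thesis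
      by blast
  qed
  have N': "submodule N R M"
    using G N by blast
  have "T {\<zero>\<^bsub>M\<^esub>} (carrier M)"
    unfolding T_def
    using zero_direct_summand carrier_direct_summand N submoduleD(1,2)[OF N'] set_add_zero[OF N']
    by (intro conjI bexI[of _ N]) auto
  then have "\<not> has_dev \<alpha> (interval_in (direct_summands R M) {\<zero>\<^bsub>M\<^esub>} (carrier M))"
    using T_strict T_split by (intro splitting_pairs_no_deviation[where T = T]) auto
  moreover have "interval_in (direct_summands R M) {\<zero>\<^bsub>M\<^esub>} (carrier M) = direct_summands R M"
    using direct_summandD[THEN submoduleD(1)] direct_summandD[THEN submoduleD(2)]
    unfolding interval_in_def by blast
  ultimately show ?thesis
    by simp
qed

section \<open>Existence of indecomposable summands\<close>

text \<open>
  If no nonzero summand of \<open>N\<close> is indecomposable, every one of them is the direct sum of two nonzero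
  submodules, which are again summands of \<open>N\<close>. The nonzero summands of \<open>N\<close> are then a family that
  splits forever.
\<close>

lemma deviation_imp_indecomposable_summand:
  fixes \<alpha> :: "'o::wellorder option"
  assumes dev: "has_dev \<alpha> (direct_summands R M)"
    and N: "N \<in> direct_summands R M" "N \<noteq> {\<zero>\<^bsub>M\<^esub>}"
  shows "\<exists>L \<in> direct_summands R (M\<lparr>carrier := N\<rparr>). L \<noteq> {\<zero>\<^bsub>M\<^esub>} \<and>
    indecomposable R (M\<lparr>carrier := L\<rparr>)"
proof (rule ccontr)
  assume contra: "\<not> ?thesis"
  define G where "G = direct_summands R (M\<lparr>carrier := N\<rparr>) - {{\<zero>\<^bsub>M\<^esub>}}"
  have N': "submodule N R M"
    using N by (simp add: direct_summandD)
  interpret N: left_module R "M\<lparr>carrier := N\<rparr>"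
    using submodule_is_left_module[OF N'] .
  have G: "submodule L R M \<and> L \<noteq> {\<zero>\<^bsub>M\<^esub>}" if "L \<in> G" for L
    using that by (auto simp: G_def direct_summands_def is_direct_sum_submodule_iff[OF N'])
  have summand: "A \<in> direct_summands R (M\<lparr>carrier := N\<rparr>)"
    if L: "L \<in> direct_summands R (M\<lparr>carrier := N\<rparr>)"
      and AB: "is_direct_sum R (M\<lparr>carrier := L\<rparr>) A B" for L A B
  proof -
    have LN: "submodule L R (M\<lparr>carrier := N\<rparr>)"
      using N.direct_summandD[OF L] .
    have AB': "submodule A R (M\<lparr>carrier := N\<rparr>)" "submodule B R (M\<lparr>carrier := N\<rparr>)"
        "A \<inter> B = {\<zero>\<^bsub>M\<^esub>}" "A <+>\<^bsub>M\<lparr>carrier := N\<rparr>\<^esub> B = L"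
      using AB N.is_direct_sum_submodule_iff[OF LN, of A B] by simp_all
    show ?thesis
      using N.direct_summand_left[OF AB'(1,2)] AB'(3,4) L by simp
  qed
  have "\<exists>L1\<in>G. \<exists>L2\<in>G. is_direct_sum R (M\<lparr>carrier := L\<rparr>) L1 L2" if "L \<in> G" for L
  proof -
    have L: "L \<in> direct_summands R (M\<lparr>carrier := N\<rparr>)" "L \<noteq> {\<zero>\<^bsub>M\<^esub>}"
      using that by (auto simp: G_def)
    then have "\<not> indecomposable R (M\<lparr>carrier := L\<rparr>)"
      using contra by blast
    then obtain A B where AB: "is_direct_sum R (M\<lparr>carrier := L\<rparr>) A B"
        "A \<noteq> {\<zero>\<^bsub>M\<^esub>}" "B \<noteq> {\<zero>\<^bsub>M\<^esub>}"
      using L(2) by (simp add: indecomposable_def) blast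
    interpret L: left_module R "M\<lparr>carrier := L\<rparr>"
      using submodule_is_left_module G that by blast
    have "A \<in> G" "B \<in> G"
      using summand[OF L(1)] AB L.direct_sum_commute[OF AB(1)] by (auto simp: G_def)
    with AB show ?thesis
      by blast
  qed
  moreover have "N \<in> G"
    using N.carrier_direct_summand N by (simp add: G_def)
  ultimately show False
    using splitting_family_no_deviation[OF G] N dev by blast
qed

section \<open>Finiteness of direct sum decompositions\<close>

text \<open>
  In a direct sum decomposition this is the set of elements whose coordinates outside \<open>J\<close> vanish.
  The finite set \<open>F\<close> may be larger than the support of \<open>c\<close>, which makes two elements easy to
  add over a common index set.
\<close>

definition partial_sum :: "('i \<Rightarrow> 'm set) \<Rightarrow> 'i set \<Rightarrow> 'm set" where
  "partial_sum N J = {finsum M c F | c F. finite F \<and> F \<subseteq> J \<and> (\<forall>i\<in>F. c i \<in> N i)}"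

lemma finsum_smult:
  assumes "r \<in> carrier R" "finite F" "\<And>i. i \<in> F \<Longrightarrow> c i \<in> carrier M"
  shows "r \<odot>\<^bsub>M\<^esub> finsum M c F = finsum M (\<lambda>i. r \<odot>\<^bsub>M\<^esub> c i) F"
  using assms(2,3)
proof (induction F rule: finite_induct)
  case empty
  show ?case
    using assms(1) by (simp add: smult_zero)
next
  case (insert i F)
  then have "c \<in> F \<rightarrow> carrier M" "c i \<in> carrier M"
    by auto
  with insert assms(1) show ?case
    by (simp add: smult_r_distr smult_closed Pi_def)
qed

lemma partial_sum_submodule:
  assumes N: "\<And>i. i \<in> J \<Longrightarrow> submodule (N i) R M"
  shows "submodule (partial_sum N J) R M"
proof (rule submoduleI)
  note sub = submodule_subset[OF N]
  show "partial_sum N J \<subseteq> carrier M"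
    using sub by (auto simp: partial_sum_def intro!: M.finsum_closed)
  have "\<zero>\<^bsub>M\<^esub> = finsum M (\<lambda>_. \<zero>\<^bsub>M\<^esub>) {}"
    by simp
  then show "\<zero>\<^bsub>M\<^esub> \<in> partial_sum N J"
    unfolding partial_sum_def by blast
  show "x \<oplus>\<^bsub>M\<^esub> y \<in> partial_sum N J" if prem: "x \<in> partial_sum N J" "y \<in> partial_sum N J" for x y
  proof -
    obtain c F d E where F: "finite F" "F \<subseteq> J" "\<forall>i\<in>F. c i \<in> N i" "x = finsum M c F"
      and E: "finite E" "E \<subseteq> J" "\<forall>i\<in>E. d i \<in> N i" "y = finsum M d E"
      using prem unfolding partial_sum_def by blast
    define c' where "c' i = (if i \<in> F then c i else \<zero>\<^bsub>M\<^esub>)" for i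
    define d' where "d' i = (if i \<in> E then d i else \<zero>\<^bsub>M\<^esub>)" for i
    have c'd': "c' i \<in> N i" "d' i \<in> N i" if "i \<in> F \<union> E" for i
      using that F E submoduleD(2)[OF N] by (auto simp: c'_def d'_def)
    then have Pi: "c' \<in> F \<union> E \<rightarrow> carrier M" "d' \<in> F \<union> E \<rightarrow> carrier M"
      using sub F E by blast+
    have "x = finsum M c' (F \<union> E)"
      unfolding F(4)
      by (rule M.add.finprod_mono_neutral_cong_left) (use F E Pi in \<open>auto simp: c'_def\<close>)
    moreover have "y = finsum M d' (F \<union> E)"
      unfolding E(4)
      by (rule M.add.finprod_mono_neutral_cong_left) (use F E Pi in \<open>auto simp: d'_def\<close>)
    ultimately have "x \<oplus>\<^bsub>M\<^esub> y = finsum M (\<lambda>i. c' i \<oplus>\<^bsub>M\<^esub> d' i) (F \<union> E)"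
      using Pi by (simp add: M.finsum_addf)
    moreover have "\<forall>i\<in>F \<union> E. c' i \<oplus>\<^bsub>M\<^esub> d' i \<in> N i"
      using c'd' submoduleD(3)[OF N] F E by blast
    moreover have "finite (F \<union> E)" "F \<union> E \<subseteq> J"
      using F E by auto
    ultimately show ?thesis
      unfolding partial_sum_def by blast
  qed
  show "r \<odot>\<^bsub>M\<^esub> x \<in> partial_sum N J" if r: "r \<in> carrier R" and prem: "x \<in> partial_sum N J" for r x
  proof -
    obtain c F where F: "finite F" "F \<subseteq> J" "\<forall>i\<in>F. c i \<in> N i" "x = finsum M c F"
      using prem unfolding partial_sum_def by blast
    have "r \<odot>\<^bsub>M\<^esub> x = finsum M (\<lambda>i. r \<odot>\<^bsub>M\<^esub> c i) F"
      unfolding F(4) by (rule finsum_smult) (use r F sub in auto)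
    moreover have "\<forall>i\<in>F. r \<odot>\<^bsub>M\<^esub> c i \<in> N i"
      using r F submoduleD(5)[OF N] by blast
    ultimately show ?thesis
      unfolding partial_sum_def using F by blast
  qed
qed

lemma summand_subset_partial_sum:
  assumes "submodule (N i) R M" "i \<in> J"
  shows "N i \<subseteq> partial_sum N J"
proof
  fix x assume x: "x \<in> N i"
  then have "x = finsum M (\<lambda>_. x) {i}"
    using submodule_subset[OF assms(1)] by simp
  moreover have "finite {i}" "{i} \<subseteq> J" "\<forall>j\<in>{i}. (\<lambda>_. x) j \<in> N j"
    using x assms by auto
  ultimately show "x \<in> partial_sum N J"
    unfolding partial_sum_def by blast
qed

lemma partial_sum_mono: "J \<subseteq> K \<Longrightarrow> partial_sum N J \<subseteq> partial_sum N K"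
  unfolding partial_sum_def by blast

lemma partial_sum_Un:
  assumes N: "\<And>i. i \<in> J \<union> K \<Longrightarrow> submodule (N i) R M"
  shows "partial_sum N (J \<union> K) = partial_sum N J <+>\<^bsub>M\<^esub> partial_sum N K"
proof
  note sub = submodule_subset[OF N]
  show "partial_sum N (J \<union> K) \<subseteq> partial_sum N J <+>\<^bsub>M\<^esub> partial_sum N K"
  proof
    fix x assume "x \<in> partial_sum N (J \<union> K)"
    then obtain c F where F: "finite F" "F \<subseteq> J \<union> K" "\<forall>i\<in>F. c i \<in> N i" "x = finsum M c F"
      unfolding partial_sum_def by blast
    have "x = finsum M c ((F \<inter> J) \<union> (F - J))"
      by (simp add: F Un_Diff_Int Un_commute)
    also have "\<dots> = finsum M c (F \<inter> J) \<oplus>\<^bsub>M\<^esub> finsum M c (F - J)"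
      by (rule M.finsum_Un_disjoint) (use F sub in auto)
    finally have x: "x = finsum M c (F \<inter> J) \<oplus>\<^bsub>M\<^esub> finsum M c (F - J)" .
    have "finite (F \<inter> J)" "F \<inter> J \<subseteq> J" "\<forall>i\<in>F \<inter> J. c i \<in> N i"
      "finite (F - J)" "F - J \<subseteq> K" "\<forall>i\<in>F - J. c i \<in> N i"
      using F by auto
    then have "finsum M c (F \<inter> J) \<in> partial_sum N J" "finsum M c (F - J) \<in> partial_sum N K"
      unfolding partial_sum_def by blast+
    with x show "x \<in> partial_sum N J <+>\<^bsub>M\<^esub> partial_sum N K"
      by (auto simp: set_add_iff)
  qed
  have "x \<oplus>\<^bsub>M\<^esub> y \<in> partial_sum N (J \<union> K)"
    if "x \<in> partial_sum N J" "y \<in> partial_sum N K" for x y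
  proof (rule submoduleD(3))
    show "submodule (partial_sum N (J \<union> K)) R M"
      using N by (rule partial_sum_submodule)
  qed (use that partial_sum_mono[of J "J \<union> K" N] partial_sum_mono[of K "J \<union> K" N] in auto)
  then show "partial_sum N J <+>\<^bsub>M\<^esub> partial_sum N K \<subseteq> partial_sum N (J \<union> K)"
    by (auto simp: set_add_iff)
qed

lemma partial_sum_index:
  assumes "direct_sum_decomposition R M I N"
  shows "partial_sum N I = carrier M"
proof
  have N: "submodule (N i) R M" if "i \<in> I" for i
    using assms that by (simp add: direct_sum_decomposition_def)
  show "partial_sum N I \<subseteq> carrier M"
    using submoduleD(1)[OF partial_sum_submodule[OF N]] .
  show "carrier M \<subseteq> partial_sum N I"
  proof
    fix x assume "x \<in> carrier M"
    then obtain c where c: "c \<in> (\<Pi>\<^sub>E i\<in>I. N i)" "finite {i\<in>I. c i \<noteq> \<zero>\<^bsub>M\<^esub>}"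
        "x = (\<Oplus>\<^bsub>M\<^esub> i\<in>{i\<in>I. c i \<noteq> \<zero>\<^bsub>M\<^esub>}. c i)"
      using assms unfolding direct_sum_decomposition_def by blast
    have "\<forall>i\<in>{i\<in>I. c i \<noteq> \<zero>\<^bsub>M\<^esub>}. c i \<in> N i"
      using c(1) by auto
    with c(2,3) show "x \<in> partial_sum N I"
      unfolding partial_sum_def mem_Collect_eq
      by (intro exI[of _ c] exI[of _ "{i\<in>I. c i \<noteq> \<zero>\<^bsub>M\<^esub>}"]) simp
  qed
qed

text \<open>
  An element of both partial sums has a coordinate family vanishing outside \<open>J\<close> and one vanishing
  outside \<open>K\<close>. Coordinates are unique, so the two families agree and vanish everywhere.
\<close>

lemma partial_sum_Int:
  assumes dec: "direct_sum_decomposition R M I N"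
    and J: "J \<subseteq> I" and K: "K \<subseteq> I" and JK: "J \<inter> K = {}"
  shows "partial_sum N J \<inter> partial_sum N K = {\<zero>\<^bsub>M\<^esub>}"
proof -
  have N: "submodule (N i) R M" if "i \<in> I" for i
    using dec that by (simp add: direct_sum_decomposition_def)
  note sub = submodule_subset[OF N]
  have coords: "\<exists>d. d \<in> (\<Pi>\<^sub>E i\<in>I. N i) \<and> finite {i\<in>I. d i \<noteq> \<zero>\<^bsub>M\<^esub>} \<and>
        x = (\<Oplus>\<^bsub>M\<^esub> i\<in>{i\<in>I. d i \<noteq> \<zero>\<^bsub>M\<^esub>}. d i) \<and> (\<forall>i\<in>I - S. d i = \<zero>\<^bsub>M\<^esub>)"
    if prem: "x \<in> partial_sum N S" "S \<subseteq> I" for x S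
  proof -
    obtain c F where F: "finite F" "F \<subseteq> S" "\<forall>i\<in>F. c i \<in> N i" "x = finsum M c F"
      using prem unfolding partial_sum_def by blast
    \<comment> \<open>Uniqueness of coordinates is a statement about families that are \<open>undefined\<close> outside \<open>I\<close>,
      hence the restriction.\<close>
    define d where "d = restrict (\<lambda>i. if i \<in> F then c i else \<zero>\<^bsub>M\<^esub>) I"
    have supp: "{i\<in>I. d i \<noteq> \<zero>\<^bsub>M\<^esub>} \<subseteq> F"
      by (auto simp: d_def)
    have "finsum M d {i\<in>I. d i \<noteq> \<zero>\<^bsub>M\<^esub>} = finsum M c F"
      by (rule M.add.finprod_mono_neutral_cong_left)
        (use F prem supp sub in \<open>auto simp: d_def split: if_splits\<close>)
    moreover have "d \<in> (\<Pi>\<^sub>E i\<in>I. N i)"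
      using F submoduleD(2)[OF N] by (auto simp: d_def)
    moreover have "finite {i\<in>I. d i \<noteq> \<zero>\<^bsub>M\<^esub>}"
      using finite_subset[OF supp F(1)] .
    moreover have "\<forall>i\<in>I - S. d i = \<zero>\<^bsub>M\<^esub>"
      using F by (auto simp: d_def)
    ultimately show ?thesis
      using F by (intro exI[of _ d]) simp
  qed
  have "x = \<zero>\<^bsub>M\<^esub>" if xJ: "x \<in> partial_sum N J" and xK: "x \<in> partial_sum N K" for x
  proof -
    have "x \<in> carrier M"
      using partial_sum_mono[OF J, of N] partial_sum_index[OF dec] xJ by blast
    then have uniq: "\<exists>!c. c \<in> (\<Pi>\<^sub>E i\<in>I. N i) \<and> finite {i\<in>I. c i \<noteq> \<zero>\<^bsub>M\<^esub>} \<and>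
        x = (\<Oplus>\<^bsub>M\<^esub> i\<in>{i\<in>I. c i \<noteq> \<zero>\<^bsub>M\<^esub>}. c i)"
      using dec unfolding direct_sum_decomposition_def by blast
    obtain d where d: "d \<in> (\<Pi>\<^sub>E i\<in>I. N i)" "finite {i\<in>I. d i \<noteq> \<zero>\<^bsub>M\<^esub>}"
        "x = (\<Oplus>\<^bsub>M\<^esub> i\<in>{i\<in>I. d i \<noteq> \<zero>\<^bsub>M\<^esub>}. d i)" "\<forall>i\<in>I - J. d i = \<zero>\<^bsub>M\<^esub>"
      using coords[OF xJ J] by blast
    obtain e where e: "e \<in> (\<Pi>\<^sub>E i\<in>I. N i)" "finite {i\<in>I. e i \<noteq> \<zero>\<^bsub>M\<^esub>}"
        "x = (\<Oplus>\<^bsub>M\<^esub> i\<in>{i\<in>I. e i \<noteq> \<zero>\<^bsub>M\<^esub>}. e i)" "\<forall>i\<in>I - K. e i = \<zero>\<^bsub>M\<^esub>"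
      using coords[OF xK K] by blast
    have "d = e"
      using uniq d(1-3) e(1-3) by blast
    then have "{i\<in>I. d i \<noteq> \<zero>\<^bsub>M\<^esub>} = {}"
      using d(4) e(4) JK by blast
    then show ?thesis
      using d(3) by (simp only: M.finsum_empty)
  qed
  moreover have "\<zero>\<^bsub>M\<^esub> \<in> partial_sum N J \<inter> partial_sum N K"
    using submoduleD(2)[OF partial_sum_submodule, of J N]
      submoduleD(2)[OF partial_sum_submodule, of K N] N J K by auto
  ultimately show ?thesis
    by blast
qed

text \<open>
  For infinite \<open>I\<close>, the partial sums over infinite subsets of \<open>I\<close> split forever: an infinite set is
  the disjoint union of two infinite sets, and the corresponding partial sums are independent.
\<close>

lemma deviation_imp_finite_decomposition:
  fixes \<alpha> :: "'o::wellorder option"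
  assumes dev: "has_dev \<alpha> (direct_summands R M)"
    and dec: "direct_sum_decomposition R M I N"
  shows "finite I"
proof (rule ccontr)
  assume I: "infinite I"
  define G where "G = partial_sum N ` {J. J \<subseteq> I \<and> infinite J}"
  have N: "submodule (N i) R M" "N i \<noteq> {\<zero>\<^bsub>M\<^esub>}" if "i \<in> I" for i
    using dec that by (simp_all add: direct_sum_decomposition_def)
  have sub: "submodule (partial_sum N J) R M" if "J \<subseteq> I" for J
    by (rule partial_sum_submodule) (use N that in auto)
  have G: "submodule L R M \<and> L \<noteq> {\<zero>\<^bsub>M\<^esub>}" if prem: "L \<in> G" for L
  proof -
    obtain J where J: "J \<subseteq> I" "infinite J" "L = partial_sum N J"
      using prem by (auto simp: G_def)
    then obtain i where i: "i \<in> J"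
      using infinite_imp_nonempty by blast
    then have "N i \<subseteq> L" "N i \<noteq> {\<zero>\<^bsub>M\<^esub>}" "\<zero>\<^bsub>M\<^esub> \<in> N i"
      using summand_subset_partial_sum[of N i J] N submoduleD(2)[OF N(1)] J by auto
    with J sub show ?thesis
      by blast
  qed
  have "\<exists>L1\<in>G. \<exists>L2\<in>G. is_direct_sum R (M\<lparr>carrier := L\<rparr>) L1 L2" if prem: "L \<in> G" for L
  proof -
    obtain J where J: "J \<subseteq> I" "infinite J" "L = partial_sum N J"
      using prem by (auto simp: G_def)
    obtain A B' where A: "A \<subseteq> J" "B' \<subseteq> J" "infinite A" "infinite B'" "A \<inter> B' = {}"
      using infinite_split[OF J(2)] .
    define B where "B = J - A"
    have "B' \<subseteq> B"
      using A by (auto simp: B_def)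
    with A have AB: "J = A \<union> B" "A \<inter> B = {}" "infinite A" "infinite B"
      using finite_subset[of B' B] by (auto simp: B_def)
    have "partial_sum N A \<inter> partial_sum N B = {\<zero>\<^bsub>M\<^esub>}"
      using partial_sum_Int[OF dec] AB J by simp
    moreover have "partial_sum N A <+>\<^bsub>M\<^esub> partial_sum N B = L"
      using partial_sum_Un[of A B N] N AB J by blast
    ultimately have "is_direct_sum R (M\<lparr>carrier := L\<rparr>) (partial_sum N A) (partial_sum N B)"
      using is_direct_sum_submodule_iff[of L] G[OF that] sub[of A] sub[of B] AB J by blast
    then show ?thesis
      using AB J by (auto simp: G_def)
  qed
  moreover have "carrier M \<in> G"
    using partial_sum_index[OF dec] I by (auto simp: G_def)
  ultimately show False
    using splitting_family_no_deviation[OF G] carrier_direct_summand dev by blast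
qed

end

theorem proposition4p3:
  fixes R :: "('r, 'b) ring_scheme"
    and M :: "('r, 'm, 'c) module_scheme"
    and \<alpha> :: "'o::wellorder option"
  assumes "left_module R M"
    and "has_dev \<alpha> (direct_summands R M)"
  shows "(\<forall>(I :: 'i set) N. direct_sum_decomposition R M I N \<longrightarrow> finite I) \<and>
    (\<forall>N \<in> direct_summands R M. N \<noteq> {\<zero>\<^bsub>M\<^esub>} \<longrightarrow>
       (\<exists>L \<in> direct_summands R (M\<lparr>carrier := N\<rparr>). L \<noteq> {\<zero>\<^bsub>M\<^esub>} \<and>
          indecomposable R (M\<lparr>carrier := L\<rparr>)))"
proof -
  interpret left_module R M by fact
  show ?thesis
    using deviation_imp_finite_decomposition[OF assms(2)]
      deviation_imp_indecomposable_summand[OF assms(2)] by blast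
qed

end
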